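(* Let $(S,N)$ be a quadratic normalisation of class $(3,3)$ and let $R=\{\,s|t\to\overline{N}(s|t): s,t\in S,\ s|t\ne\overline{N}(s|t)\,\}$. Then the rewriting system $(S,R)$ is convergent; and if $e\in S$ is an $N$-neutral element, then the rewriting system $(S_e,R_e)$ is convergent as well, where $S_e=S\setminus\{e\}$ and $R_e=\{\,s|t\to\pi_e(\overline{N}(s|t)): s,t\in S_e,\ s|t\ne\overline{N}(s|t)\,\}$. More precisely, every rewriting sequence $w_0\to_R w_1\to_R\cdots\to_R w_\ell$ starting from a word of length $p$ satisfies $\ell\le p(p-1)/2$.
   Context: For a set $S$, $S^*$ is the free monoid of words over $S$, $\|w\|$ is word length, $u|v$ is concatenation, $S^{[p]}$ is the set of words of length $p$. A normalisation is a pair $(S,N)$ with $N:S^*\to S^*$ such that for all words $u,v,w$: $\|N(w)\|=\|w\|$; $\|w\|=1$ implies $N(w)=w$; $N(u|N(w)|v)=N(u|w|v)$. A word is $N$-normal if $N(w)=w$. $\overline{N}$ is the restriction of $N$ to $S^{[2]}$; $\overline{N}_i$ applies $\overline{N}$ to the entries in positions $i,i+1$; $\overline{N}_{i_1\cdots i_n}=\overline{N}_{i_n}\circ\cdots\circ\overline{N}_{i_1}$. $(S,N)$ is quadratic if (a) a word is $N$-normal iff each of its length-two factors is, and (b) for every word $w$ there is a finite sequence $u$ of positions with $N(w)=\overline{N}_u(w)$. It is of class $(3,3)$ if $N(w)=\overline{N}_{121}(w)=\overline{N}_{212}(w)$ for all $w\in S^{[3]}$. $e\in S$ is $N$-neutral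 if $N(w|e)=N(e|w)=N(w)|e$ for every word $w$. $\pi_e:S^*\to S_e^*$ is the monoid morphism erasing $e$ and fixing the other letters. A rewriting system $(S,R)$ is a set $S$ with a set $R$ of rules $w\to w'$ between words over $S$; $\to_R$ is the relation $u|w|v\to_R u|w'|v$ for $u,v\in S^*$, $w\to w'$ in $R$; $\to_R^*$ is its reflexive-transitive closure. It is confluent if $w\to_R^*w_1$, $w\to_R^*w_2$ imply $w_1\to_R^*w'$, $w_2\to_R^*w'$ for some $w'$; it terminates if there is no infinite sequence of $\to_R$-steps; convergent means confluent and terminating. *)

theory Defs
  imports "HOL-Library.Sublist" "HOL-Library.Confluence"
begin

text \<open>Words over \<open>S\<close> are the lists in \<^term>\<open>lists S\<close>; the letters of the ambient type outside
  \<open>S\<close> play no role, and the values of \<open>N\<close> outside \<^term>\<open>lists S\<close> are unconstrained.\<close>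

definition normalisation :: "'a set \<Rightarrow> ('a list \<Rightarrow> 'a list) \<Rightarrow> bool" where
  "normalisation S N \<longleftrightarrow>
     (\<forall>w\<in>lists S. N w \<in> lists S) \<and>
     (\<forall>w\<in>lists S. length (N w) = length w) \<and>
     (\<forall>w\<in>lists S. length w = 1 \<longrightarrow> N w = w) \<and>
     (\<forall>u\<in>lists S. \<forall>v\<in>lists S. \<forall>w\<in>lists S. N (u @ N w @ v) = N (u @ w @ v))"

definition normal_word :: "('a list \<Rightarrow> 'a list) \<Rightarrow> 'a list \<Rightarrow> bool" where
  "normal_word N w \<longleftrightarrow> N w = w"

text \<open>Positions are counted from 1, and \<open>Nbar_at N i w\<close> is only meaningful for
  \<open>1 \<le> i < length w\<close>.\<close>

definition Nbar_at :: "('a list \<Rightarrow> 'a list) \<Rightarrow> nat \<Rightarrow> 'a list \<Rightarrow> 'a list" where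
  "Nbar_at N i w = take (i - 1) w @ N [w ! (i - 1), w ! i] @ drop (i + 1) w"

text \<open>The first position of the sequence is the first one applied.\<close>

definition Nbar_seq :: "('a list \<Rightarrow> 'a list) \<Rightarrow> nat list \<Rightarrow> 'a list \<Rightarrow> 'a list" where
  "Nbar_seq N is w = fold (Nbar_at N) is w"

definition quadratic_normalisation :: "'a set \<Rightarrow> ('a list \<Rightarrow> 'a list) \<Rightarrow> bool" where
  "quadratic_normalisation S N \<longleftrightarrow>
     normalisation S N \<and>
     (\<forall>w\<in>lists S. normal_word N w \<longleftrightarrow>
        (\<forall>x. sublist x w \<and> length x = 2 \<longrightarrow> normal_word N x)) \<and>
     (\<forall>w\<in>lists S. \<exists>is. set is \<subseteq> {1..<length w} \<and> N w = Nbar_seq N is w)"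

definition class_3_3 :: "'a set \<Rightarrow> ('a list \<Rightarrow> 'a list) \<Rightarrow> bool" where
  "class_3_3 S N \<longleftrightarrow>
     (\<forall>w\<in>lists S. length w = 3 \<longrightarrow>
        N w = Nbar_seq N [1, 2, 1] w \<and> N w = Nbar_seq N [2, 1, 2] w)"

definition neutral_element :: "'a set \<Rightarrow> ('a list \<Rightarrow> 'a list) \<Rightarrow> 'a \<Rightarrow> bool" where
  "neutral_element S N e \<longleftrightarrow>
     e \<in> S \<and> (\<forall>w\<in>lists S. N (w @ [e]) = N w @ [e] \<and> N (e # w) = N w @ [e])"

definition erase :: "'a \<Rightarrow> 'a list \<Rightarrow> 'a list" where
  "erase e w = filter (\<lambda>s. s \<noteq> e) w"

definition rewriting_system :: "'a set \<Rightarrow> ('a list \<times> 'a list) set \<Rightarrow> bool" where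
  "rewriting_system S R \<longleftrightarrow> R \<subseteq> lists S \<times> lists S"

definition rewrite_step ::
  "'a set \<Rightarrow> ('a list \<times> 'a list) set \<Rightarrow> 'a list \<Rightarrow> 'a list \<Rightarrow> bool" where
  "rewrite_step S R x y \<longleftrightarrow>
     (\<exists>u\<in>lists S. \<exists>v\<in>lists S. \<exists>(w, w')\<in>R. x = u @ w @ v \<and> y = u @ w' @ v)"

definition terminating :: "'a set \<Rightarrow> ('a list \<times> 'a list) set \<Rightarrow> bool" where
  "terminating S R \<longleftrightarrow> \<not> (\<exists>f :: nat \<Rightarrow> 'a list. \<forall>i. rewrite_step S R (f i) (f (Suc i)))"

text \<open>For a rewriting system on \<open>S\<close>, a list outside \<^term>\<open>lists S\<close> is neither source nor target
  of a step, so confluence on the whole list type is confluence on \<^term>\<open>lists S\<close>.\<close>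

definition convergent_rewriting :: "'a set \<Rightarrow> ('a list \<times> 'a list) set \<Rightarrow> bool" where
  "convergent_rewriting S R \<longleftrightarrow>
     rewriting_system S R \<and> confluentp (rewrite_step S R) \<and> terminating S R"

definition norm_rules :: "'a set \<Rightarrow> ('a list \<Rightarrow> 'a list) \<Rightarrow> ('a list \<times> 'a list) set" where
  "norm_rules S N = {([s, t], N [s, t]) | s t. s \<in> S \<and> t \<in> S \<and> [s, t] \<noteq> N [s, t]}"

definition norm_rules_erased ::
  "'a set \<Rightarrow> ('a list \<Rightarrow> 'a list) \<Rightarrow> 'a \<Rightarrow> ('a list \<times> 'a list) set" where
  "norm_rules_erased S N e =
     {([s, t], erase e (N [s, t])) | s t.
        s \<in> S - {e} \<and> t \<in> S - {e} \<and> [s, t] \<noteq> N [s, t]}"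

end

(* The maps N_1, N_2, ... on words, where N_i normalises the two letters in positions i and i + 1,
   are idempotent, commute at distance at least 2 and satisfy the braid relations by class (3,3):
   they define an action of the 0-Hecke monoid. Let B_k,m be the product of m factors that applies
   N_k first, then N_(k-1), and so on downwards. Every product of N_1, ..., N_n is equal to a
   canonical one applying in turn B_1,m(1), ..., B_n,m(n) with m(k) <= k, and one further N_i either
   is absorbed by the canonical product or lengthens it by exactly one. A rewriting step changes
   the word, so it is never absorbed, and the length of a rewriting sequence is at most the largest
   length n(n+1)/2 of a canonical product, with n = p - 1. Confluence follows because N is
   invariant under rewriting and fixes irreducible words. For R_e, the steps that preserve the
   length are steps of R, and the invariant is N followed by the erasure of e. *)

theory Submission
  imports Defs
begin

section \<open>Canonical products of 0-Hecke generators\<close>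

locale hecke_maps =
  fixes F :: "nat \<Rightarrow> 'b \<Rightarrow> 'b"
  assumes idem: "F i (F i x) = F i x"
    and comm: "i + 2 \<le> j \<Longrightarrow> F i (F j x) = F j (F i x)"
    and braid: "F i (F (Suc i) (F i x)) = F (Suc i) (F i (F (Suc i) x))"
begin

text \<open>This is B_k,m of the idea above with k = \<open>n + 1\<close>, as the indices of
  \<open>F\<close> start at 0. For m <= n + 1 the subtraction is never truncated, and the factors
  run from \<open>F n\<close> down to \<open>F (n + 1 - m)\<close>.\<close>

primrec block :: "nat \<Rightarrow> nat \<Rightarrow> 'b \<Rightarrow> 'b" where
  "block n 0 x = x"
| "block n (Suc m) x = F (n - m) (block n m x)"

text \<open>The number of factors is carried along with the map, since different products may give
  the same map.\<close>

primrec canonical :: "nat \<Rightarrow> (nat \<times> ('b \<Rightarrow> 'b)) set" where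
  "canonical 0 = {(0, id)}"
| "canonical (Suc n) = {(k + m, block n m \<circ> g) | k m g. (k, g) \<in> canonical n \<and> m \<le> Suc n}"

text \<open>Every factor of the block has index at least \<open>i + 2\<close>.\<close>

lemma block_commute_below: "i + m < n \<Longrightarrow> F i (block n m x) = block n m (F i x)"
proof (induction m)
  case (Suc m)
  then show ?case using comm[of i "n - m"] by simp
qed simp

text \<open>Both \<open>F i\<close> and \<open>F (i - 1)\<close> are factors of the block. The outer
  \<open>F i\<close> commutes with the factors of index at most \<open>i - 2\<close>, the braid
  relation turns it into an inner \<open>F (i - 1)\<close>, and this one commutes with the factors
  of index at least \<open>i + 1\<close>.\<close>

lemma block_commute_above:
  "i \<le> n \<Longrightarrow> n + 1 < i + m \<Longrightarrow> m \<le> Suc n \<Longrightarrow>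
    F i (block n m x) = block n m (F (i - 1) x)"
proof (induction m)
  case (Suc m)
  show ?case
  proof (cases "n + 1 < i + m")
    case True
    then have "F i (F (n - m) y) = F (n - m) (F i y)" for y
      using comm[of "n - m" i y] Suc.prems by simp
    then show ?thesis using Suc True by simp
  next
    case False
    with Suc.prems obtain k j where k: "m = Suc k" and j: "i = Suc j" "n - m = j" "n - k = i"
      by (cases m; cases i) auto
    have "F j (block n k x) = block n k (F j x)"
      using j k Suc.prems by (intro block_commute_below) linarith
    then show ?thesis using j k braid[of j "block n k x"] by simp
  qed
qed simp

lemma canonical_extend:
  "(k, g) \<in> canonical n \<Longrightarrow> i < n \<Longrightarrow> F i \<circ> g = g \<or> (Suc k, F i \<circ> g) \<in> canonical n"
proof (induction n arbitrary: k g i)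
  case (Suc n)
  then obtain k' m g' where kg: "k = k' + m" "g = block n m \<circ> g'" "(k', g') \<in> canonical n"
    and m: "m \<le> Suc n" by auto
  \<comment> \<open>If \<open>F i\<close> passes through the last block, it arrives as a generator
    \<open>F j\<close> of the smaller product, and the induction hypothesis applies.\<close>
  have shift: ?case if "j < n" "\<And>x. F i (block n m x) = block n m (F j x)" for j
  proof -
    have eq: "F i \<circ> g = block n m \<circ> (F j \<circ> g')" using that kg by auto
    from Suc.IH[OF kg(3) that(1)] show ?thesis
    proof
      assume "F j \<circ> g' = g'"
      then have "F i \<circ> g = g" using eq kg(2) by simp
      then show ?thesis ..
    next
      assume "(Suc k', F j \<circ> g') \<in> canonical n"
      then have "(Suc k' + m, block n m \<circ> (F j \<circ> g')) \<in> canonical (Suc n)"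
        using m unfolding canonical.simps by blast
      then show ?thesis using eq kg(1) by (metis add_Suc)
    qed
  qed
  \<comment> \<open>In turn: \<open>F i\<close> commutes with the last block, prolongs it by one
    factor, repeats its final factor, or passes through it as \<open>F (i - 1)\<close>.\<close>
  consider "i + m < n" | "i + m = n" | "i + m = Suc n" | "Suc n < i + m" by linarith
  then show ?case
  proof cases
    case 1
    then show ?thesis using shift[of i] block_commute_below by simp
  next
    case 2
    then have "F i \<circ> g = block n (Suc m) \<circ> g'" using kg by auto
    moreover have "Suc k = k' + Suc m" "Suc m \<le> Suc n" using 2 kg by auto
    ultimately have "(Suc k, F i \<circ> g) \<in> canonical (Suc n)"
      using kg(3) unfolding canonical.simps by blast
    then show ?thesis by (rule disjI2)
  next
    case 3
    then obtain m' where "m = Suc m'" "n - m' = i" using Suc.prems by (cases m) auto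
    then have "F i \<circ> g = g" using kg by (auto simp: idem)
    then show ?thesis by simp
  next
    case 4
    then show ?thesis using shift[of "i - 1"] block_commute_above[of i n m] Suc.prems m by (cases i) auto
  qed
qed simp

lemma canonical_length: "(k, g) \<in> canonical n \<Longrightarrow> k \<le> Suc n * n div 2"
proof (induction n arbitrary: k g)
  case (Suc n)
  then obtain k' m g' where "k = k' + m" "(k', g') \<in> canonical n" "m \<le> Suc n" by auto
  moreover from this have "k' \<le> Suc n * n div 2" using Suc.IH by blast
  moreover have "Suc (Suc n) * Suc n div 2 = Suc n * n div 2 + Suc n" by simp
  ultimately show ?case by linarith
qed simp

lemma id_canonical: "(0, id) \<in> canonical n"
proof (induction n)
  case (Suc n)
  have "block n 0 \<circ> id = id" by (rule ext) simp
  then show ?case using Suc unfolding canonical.simps by force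
qed (simp add: id_def)

lemma strict_chain_length:
  assumes "\<And>i. i < l \<Longrightarrow> \<exists>j<n. w (Suc i) = F j (w i) \<and> w (Suc i) \<noteq> w i"
  shows "l \<le> Suc n * n div 2"
proof -
  have "\<exists>g. (i, g) \<in> canonical n \<and> w i = g (w 0)" if "i \<le> l" for i
    using that
  proof (induction i)
    case 0
    show ?case using id_canonical by (auto intro!: exI[of _ id])
  next
    case (Suc i)
    then obtain g where g: "(i, g) \<in> canonical n" "w i = g (w 0)" by auto
    obtain j where j: "j < n" "w (Suc i) = F j (w i)" "w (Suc i) \<noteq> w i"
      using assms[of i] Suc.prems by auto
    \<comment> \<open>If \<open>g\<close> absorbed \<open>F j\<close>, the step would leave
      \<open>w i\<close> unchanged.\<close>
    then have "F j \<circ> g \<noteq> g" using g by (metis comp_apply)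
    then have "(Suc i, F j \<circ> g) \<in> canonical n" using canonical_extend g j by blast
    then show ?case using g j by auto
  qed
  then show ?thesis using canonical_length by blast
qed

end

section \<open>Convergence from an invariant\<close>

lemma irreducible_reachable:
  assumes "terminating S R"
  obtains y where "(rewrite_step S R)\<^sup>*\<^sup>* x y" "\<nexists>z. rewrite_step S R y z"
proof (rule ccontr)
  assume "\<not> thesis"
  then have "\<forall>y. (rewrite_step S R)\<^sup>*\<^sup>* x y \<longrightarrow> (\<exists>z. rewrite_step S R y z)" using that by blast
  \<comment> \<open>Dependent choice yields an infinite rewriting sequence; reachability from
    \<open>x\<close> keeps it extendable.\<close>
  then have "\<exists>f. \<forall>n. (rewrite_step S R)\<^sup>*\<^sup>* x (f n) \<and> rewrite_step S R (f n) (f (Suc n))"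
    by (intro dependent_nat_choice) (auto intro: rtranclp.rtrancl_into_rtrancl)
  then show False using assms unfolding terminating_def by blast
qed

lemma rewrite_stepI:
  "u \<in> lists S \<Longrightarrow> v \<in> lists S \<Longrightarrow> (w, w') \<in> R \<Longrightarrow> rewrite_step S R (u @ w @ v) (u @ w' @ v)"
  unfolding rewrite_step_def by blast

lemma rewrite_step_iff:
  "rewrite_step S R x y \<longleftrightarrow>
    (\<exists>u v w w'. u \<in> lists S \<and> v \<in> lists S \<and> (w, w') \<in> R \<and> x = u @ w @ v \<and> y = u @ w' @ v)"
  unfolding rewrite_step_def by blast

lemma rewrite_step_in_lists:
  assumes "rewriting_system S R" "rewrite_step S R x y"
  shows "x \<in> lists S" "y \<in> lists S"
  using assms unfolding rewriting_system_def rewrite_step_def by fastforce+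

text \<open>Each word \<open>x\<close> rewrites to an irreducible \<open>y\<close>, and then
  \<open>f x = f y = y\<close>. So all words reachable from \<open>x\<close> rewrite to the common
  word \<open>f x\<close>.\<close>

lemma convergent_by_invariant:
  assumes R: "rewriting_system S R" and "terminating S R"
    and step: "\<And>x y. rewrite_step S R x y \<Longrightarrow> f x = f y"
    and irr: "\<And>x. x \<in> lists S \<Longrightarrow> \<nexists>y. rewrite_step S R x y \<Longrightarrow> f x = x"
  shows "convergent_rewriting S R"
proof -
  \<comment> \<open>\<open>confluentp\<close> ranges over all lists, so the invariant is extended by
    the identity outside \<open>lists S\<close>.\<close>
  define g where "g x = (if x \<in> lists S then f x else x)" for x
  have steps: "g x = g y" if "(rewrite_step S R)\<^sup>*\<^sup>* x y" for x y
    using that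
  proof induction
    case (step y z)
    then show ?case using assms(3)[of y z] rewrite_step_in_lists[OF R, of y z] by (simp add: g_def)
  qed simp
  have to_g: "(rewrite_step S R)\<^sup>*\<^sup>* x (g x)" for x
  proof -
    obtain y where y: "(rewrite_step S R)\<^sup>*\<^sup>* x y" "\<nexists>z. rewrite_step S R y z"
      using irreducible_reachable[OF assms(2)] by blast
    have "g y = y" using y(2) irr by (simp add: g_def)
    then show ?thesis using y steps by metis
  qed
  have "confluentp (rewrite_step S R)"
    by (rule confluentpI) (metis steps to_g)
  then show ?thesis using assms unfolding convergent_rewriting_def by blast
qed

section \<open>Quadratic normalisations of class (3,3)\<close>

lemma Nbar_at_append:
  "length u = i \<Longrightarrow> Nbar_at N (Suc i) (u @ a # b # v) = u @ N [a, b] @ v"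
  by (auto simp: Nbar_at_def nth_append)

lemma split_at_pair:
  assumes "Suc i < length w"
  obtains u a b v where "w = u @ a # b # v" "length u = i"
proof
  show "w = take i w @ w ! i # w ! Suc i # drop (Suc (Suc i)) w"
    using assms by (metis Cons_nth_drop_Suc Suc_lessD append_take_drop_id)
qed (use assms in simp)

locale quadratic_3_3 =
  fixes S :: "'a set" and N :: "'a list \<Rightarrow> 'a list"
  assumes quadratic: "quadratic_normalisation S N"
    and class33: "class_3_3 S N"
begin

lemma N_lists: "w \<in> lists S \<Longrightarrow> N w \<in> lists S"
  and N_length: "w \<in> lists S \<Longrightarrow> length (N w) = length w"
  and N_inner: "u \<in> lists S \<Longrightarrow> v \<in> lists S \<Longrightarrow> w \<in> lists S \<Longrightarrow> N (u @ N w @ v) = N (u @ w @ v)"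
  using quadratic unfolding quadratic_normalisation_def normalisation_def by auto

lemma N_idem: "w \<in> lists S \<Longrightarrow> N (N w) = N w"
  using N_inner[of "[]" "[]" w] by simp

text \<open>This half of condition (a) makes irreducible words \<open>N\<close>-normal.\<close>

lemma N_fixes_if_factors_fixed:
  assumes "w \<in> lists S" "\<And>u s t v. w = u @ [s, t] @ v \<Longrightarrow> N [s, t] = [s, t]"
  shows "N w = w"
proof -
  have "normal_word N x" if x: "sublist x w" "length x = 2" for x
  proof -
    obtain s t where "x = [s, t]" using x(2) by (auto simp: numeral_2_eq_2 length_Suc_conv)
    then show ?thesis using x(1) assms(2) by (auto simp: sublist_def normal_word_def)
  qed
  then show ?thesis
    using assms(1) quadratic unfolding quadratic_normalisation_def normal_word_def by blast
qed

lemma N_pair_letters: "x \<in> set (N [a, b]) \<Longrightarrow> a \<in> S \<Longrightarrow> b \<in> S \<Longrightarrow> x \<in> S"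
  using N_lists[of "[a, b]"] by auto

lemma N_pair:
  assumes "a \<in> S" "b \<in> S"
  obtains c d where "N [a, b] = [c, d]" "c \<in> S" "d \<in> S" "N [c, d] = [c, d]"
proof -
  have "length (N [a, b]) = 2" "N [a, b] \<in> lists S" "N (N [a, b]) = N [a, b]"
    using assms N_length[of "[a, b]"] N_lists[of "[a, b]"] N_idem[of "[a, b]"] by auto
  then show ?thesis using that by (auto simp: numeral_2_eq_2 length_Suc_conv)
qed

section \<open>The 0-Hecke relations for normalisation at a position\<close>

text \<open>Indexed from 0: \<open>F i\<close> acts at positions \<open>i + 1\<close> and \<open>i + 2\<close>. Extending by the identity
  keeps the 0-Hecke relations, also when only one of \<open>F i\<close>, \<open>F (Suc i)\<close> is in range.\<close>

definition F :: "nat \<Rightarrow> 'a list \<Rightarrow> 'a list" where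
  "F i w = (if w \<in> lists S \<and> Suc i < length w then Nbar_at N (Suc i) w else w)"

lemma F_append:
  "length u = i \<Longrightarrow> u \<in> lists S \<Longrightarrow> v \<in> lists S \<Longrightarrow> a \<in> S \<Longrightarrow> b \<in> S \<Longrightarrow>
    F i (u @ a # b # v) = u @ N [a, b] @ v"
  unfolding F_def by (simp add: Nbar_at_append)

lemma F_out: "\<not> (w \<in> lists S \<and> Suc i < length w) \<Longrightarrow> F i w = w"
  unfolding F_def by (rule if_not_P)

lemma F_lists: "F i w \<in> lists S \<longleftrightarrow> w \<in> lists S"
  and F_length: "length (F i w) = length w"
proof -
  have "(F i w \<in> lists S \<longleftrightarrow> w \<in> lists S) \<and> length (F i w) = length w"
  proof (cases "w \<in> lists S \<and> Suc i < length w")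
    case True
    then obtain u a b v where w: "w = u @ a # b # v" "length u = i" using split_at_pair by blast
    have "a \<in> S" "b \<in> S" using True w by auto
    then obtain c d where "N [a, b] = [c, d]" "c \<in> S" "d \<in> S" using N_pair by blast
    then show ?thesis using True w by (simp add: F_append)
  qed (simp add: F_out)
  then show "F i w \<in> lists S \<longleftrightarrow> w \<in> lists S" "length (F i w) = length w" by auto
qed

lemma F_idem: "F i (F i w) = F i w"
proof (cases "w \<in> lists S \<and> Suc i < length w")
  case True
  then obtain u a b v where w: "w = u @ a # b # v" "length u = i" using split_at_pair by blast
  have "a \<in> S" "b \<in> S" using True w by auto
  then obtain c d where "N [a, b] = [c, d]" "c \<in> S" "d \<in> S" "N [c, d] = [c, d]"
    using N_pair by blast
  then show ?thesis using True w by (simp add: F_append)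
qed (simp add: F_out)

lemma F_comm:
  assumes "i + 2 \<le> j"
  shows "F i (F j w) = F j (F i w)"
proof (cases "w \<in> lists S \<and> Suc j < length w")
  case True
  then have "Suc i < length w" using assms by simp
  then obtain u a b v where w: "w = u @ a # b # v" "length u = i" using split_at_pair by blast
  moreover have "Suc (j - i - 2) < length v"
  proof -
    have "Suc j < i + 2 + length v" using True w by auto
    then show ?thesis using assms by linarith
  qed
  then obtain x c d y where v: "v = x @ c # d # y" "length x = j - i - 2"
    using split_at_pair by blast
  have S: "u \<in> lists S" "x \<in> lists S" "y \<in> lists S" "a \<in> S" "b \<in> S" "c \<in> S" "d \<in> S"
    using True w v by auto
  obtain a' b' where ab: "N [a, b] = [a', b']" "a' \<in> S" "b' \<in> S" using N_pair[OF S(4,5)] by blast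
  obtain c' d' where cd: "N [c, d] = [c', d']" "c' \<in> S" "d' \<in> S" using N_pair[OF S(6,7)] by blast
  \<comment> \<open>The letters \<open>p\<close> and \<open>q\<close> are arbitrary because
    \<open>F j\<close> is needed both before and after \<open>F i\<close> has replaced
    \<open>a\<close> and \<open>b\<close>.\<close>
  have "F j ((u @ [p, q] @ x) @ c # d # y) = (u @ [p, q] @ x) @ [c', d'] @ y"
    if "p \<in> S" "q \<in> S" for p q
    using that S w(2) v(2) assms cd(1) by (subst F_append) auto
  then have "F j (u @ p # q # x @ c # d # y) = u @ p # q # x @ c' # d' # y"
    if "p \<in> S" "q \<in> S" for p q
    using that by simp
  then show ?thesis using S ab cd w v by (simp add: F_append)
qed (auto simp: F_out F_lists F_length)

text \<open>By class (3,3) both sides are equal to \<open>N [a, b, c]\<close>.\<close>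

lemma braid_three:
  assumes "a \<in> S" "b \<in> S" "c \<in> S"
  shows "Nbar_at N (Suc 0) (Nbar_at N 2 (Nbar_at N (Suc 0) [a, b, c]))
    = Nbar_at N 2 (Nbar_at N (Suc 0) (Nbar_at N 2 [a, b, c]))"
  using class33 assms unfolding class_3_3_def Nbar_seq_def
  by (auto dest!: bspec[where x = "[a, b, c]"])

text \<open>Carries computations on a factor of three letters over to the whole word, for the braid
  relation.\<close>

lemma F_shift:
  assumes "u \<in> lists S" "w \<in> lists S" "v \<in> lists S" "Suc i < length w"
  shows "F (length u + i) (u @ w @ v) = u @ F i w @ v"
proof -
  obtain x a b y where w: "w = x @ a # b # y" "length x = i" using split_at_pair assms(4) by blast
  then have "F (length u + i) ((u @ x) @ a # b # (y @ v)) = (u @ x) @ N [a, b] @ (y @ v)"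
    using assms by (intro F_append) auto
  then show ?thesis using w assms by (simp add: F_append)
qed

lemma F_braid: "F i (F (Suc i) (F i w)) = F (Suc i) (F i (F (Suc i) w))"
proof (cases "w \<in> lists S \<and> Suc (Suc i) < length w")
  case True
  then have "Suc i < length w" by simp
  then obtain u a b v' where u: "w = u @ a # b # v'" "length u = i" using split_at_pair by blast
  then obtain c v where v: "v' = c # v" using True by (cases v') auto
  have S: "u \<in> lists S" "v \<in> lists S" "[a, b, c] \<in> lists S" using True u v by auto
  have shift: "F i (u @ x @ v) = u @ F 0 x @ v" "F (Suc i) (u @ x @ v) = u @ F (Suc 0) x @ v"
    if "x \<in> lists S" "length x = 3" for x
    using F_shift[of u x v 0] F_shift[of u x v 1] that S u by auto
  have Nbar: "Nbar_at N (Suc 0) x = F 0 x" "Nbar_at N 2 x = F (Suc 0) x" if "x \<in> lists S" "length x = 3" for x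
    using that by (auto simp: F_def numeral_2_eq_2)
  have "F 0 (F (Suc 0) (F 0 [a, b, c])) = F (Suc 0) (F 0 (F (Suc 0) [a, b, c]))"
    using braid_three[of a b c] S by (simp add: Nbar F_lists F_length)
  moreover have "w = u @ [a, b, c] @ v" using u v by simp
  ultimately show ?thesis
    using S by (simp add: shift F_lists F_length del: append_Cons)
next
  case False
  \<comment> \<open>\<open>F (Suc i)\<close> is the identity on every word that occurs here, so the
    relation reduces to idempotence of \<open>F i\<close>.\<close>
  then have "F (Suc i) x = x" if "length x = length w" "x \<in> lists S \<longleftrightarrow> w \<in> lists S" for x
    using that by (intro F_out) auto
  then show ?thesis by (simp add: F_idem F_length F_lists)
qed

sublocale hecke_maps F
  by unfold_locales (rule F_idem F_comm F_braid | assumption)+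

section \<open>Length bound, termination and confluence for \<open>norm_rules\<close>\<close>

lemma norm_step_cases:
  assumes "rewrite_step S (norm_rules S N) x y"
  obtains u v s t where "u \<in> lists S" "v \<in> lists S" "s \<in> S" "t \<in> S"
    "[s, t] \<noteq> N [s, t]" "x = u @ [s, t] @ v" "y = u @ N [s, t] @ v"
  using assms unfolding norm_rules_def rewrite_step_iff by blast

lemma norm_step_F:
  assumes "rewrite_step S (norm_rules S N) x y"
  obtains i where "x \<in> lists S" "Suc i < length x" "y = F i x" "y \<noteq> x"
proof -
  obtain u v s t where *: "u \<in> lists S" "v \<in> lists S" "s \<in> S" "t \<in> S" "[s, t] \<noteq> N [s, t]"
    and xy: "x = u @ [s, t] @ v" "y = u @ N [s, t] @ v"
    by (rule norm_step_cases[OF assms])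
  show ?thesis
  proof (rule that[of "length u"])
    show "y = F (length u) x" using * by (simp add: xy F_append)
    show "y \<noteq> x" using *(5) unfolding xy by (metis append_same_eq same_append_eq)
  qed (use * in \<open>simp_all add: xy\<close>)
qed

lemma norm_rewriting_length:
  assumes "\<And>i. i < l \<Longrightarrow> rewrite_step S (norm_rules S N) (w i) (w (Suc i))"
  shows "l \<le> length (w 0) * (length (w 0) - 1) div 2"
proof -
  \<comment> \<open>The maps in range are \<open>F j\<close> with \<open>j < n\<close>, one for each
    pair of neighbouring letters.\<close>
  define n where "n = length (w 0) - 1"
  have len: "length (w i) = length (w 0)" if "i \<le> l" for i
    using that
  proof (induction i)
    case (Suc i)
    then show ?case
      using assms[of i] norm_step_F[of "w i" "w (Suc i)"] F_length by (metis Suc_leD Suc_le_lessD)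
  qed simp
  have "\<exists>j<n. w (Suc i) = F j (w i) \<and> w (Suc i) \<noteq> w i" if i: "i < l" for i
  proof -
    obtain j where "Suc j < length (w i)" "w (Suc i) = F j (w i)" "w (Suc i) \<noteq> w i"
      using norm_step_F[OF assms[OF i]] by blast
    moreover have "length (w i) = length (w 0)" using len[of i] i by simp
    ultimately show ?thesis unfolding n_def by (intro exI[of _ j]) auto
  qed
  then have "l \<le> Suc n * n div 2" by (rule strict_chain_length)
  \<comment> \<open>For the empty word, truncation gives \<open>n = 0\<close> and both bounds are
    0.\<close>
  then show ?thesis by (cases "length (w 0)") (auto simp: n_def)
qed

lemma norm_rules_rewriting_system: "rewriting_system S (norm_rules S N)"
  unfolding rewriting_system_def norm_rules_def by (auto dest: N_pair_letters)

lemma norm_rules_terminating: "terminating S (norm_rules S N)"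
  unfolding terminating_def
proof
  assume "\<exists>f. \<forall>i. rewrite_step S (norm_rules S N) (f i) (f (Suc i))"
  then obtain f where f: "\<And>i. rewrite_step S (norm_rules S N) (f i) (f (Suc i))" by blast
  \<comment> \<open>The bound is applied to an initial part with one step more than it
    allows.\<close>
  have "Suc (length (f 0) * (length (f 0) - 1) div 2) \<le> length (f 0) * (length (f 0) - 1) div 2"
    using f by (intro norm_rewriting_length)
  then show False by simp
qed

lemma norm_rules_convergent: "convergent_rewriting S (norm_rules S N)"
proof (rule convergent_by_invariant[where f = N])
  fix x y
  assume step: "rewrite_step S (norm_rules S N) x y"
  obtain u v s t where "u \<in> lists S" "v \<in> lists S" "s \<in> S" "t \<in> S" "[s, t] \<noteq> N [s, t]"
    and xy: "x = u @ [s, t] @ v" "y = u @ N [s, t] @ v"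
    by (rule norm_step_cases[OF step])
  then have "N (u @ N [s, t] @ v) = N (u @ [s, t] @ v)" by (intro N_inner) auto
  then show "N x = N y" unfolding xy ..
next
  fix x
  assume x: "x \<in> lists S" "\<nexists>y. rewrite_step S (norm_rules S N) x y"
  show "N x = x"
  proof (rule N_fixes_if_factors_fixed[OF x(1)], rule ccontr)
    fix u s t v
    assume eq: "x = u @ [s, t] @ v" and "N [s, t] \<noteq> [s, t]"
    then have "([s, t], N [s, t]) \<in> norm_rules S N" using x(1) by (auto simp: norm_rules_def)
    then have "rewrite_step S (norm_rules S N) x (u @ N [s, t] @ v)"
      unfolding eq by (intro rewrite_stepI) (use x(1) eq in auto)
    then show False using x(2) by blast
  qed
qed (rule norm_rules_rewriting_system norm_rules_terminating)+

section \<open>Erasing a neutral element\<close>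

lemma erased_rules_rewriting_system: "rewriting_system (S - {e}) (norm_rules_erased S N e)"
  unfolding rewriting_system_def norm_rules_erased_def erase_def by (auto dest: N_pair_letters)

lemma erased_step_cases:
  assumes "rewrite_step (S - {e}) (norm_rules_erased S N e) x y"
  obtains u v s t where "u \<in> lists (S - {e})" "v \<in> lists (S - {e})" "s \<in> S - {e}" "t \<in> S - {e}"
    "[s, t] \<noteq> N [s, t]" "x = u @ [s, t] @ v" "y = u @ erase e (N [s, t]) @ v"
  using assms unfolding norm_rules_erased_def rewrite_step_iff by blast

text \<open>No step increases the length, so an infinite sequence eventually has constant length. A
  step preserving the length erases nothing and is a step of \<open>norm_rules S N\<close>, which
  terminates.\<close>

lemma erased_rules_terminating: "terminating (S - {e}) (norm_rules_erased S N e)"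
  unfolding terminating_def
proof
  let ?step = "rewrite_step (S - {e}) (norm_rules_erased S N e)"
  assume "\<exists>f. \<forall>i. ?step (f i) (f (Suc i))"
  then obtain f where f: "\<And>i. ?step (f i) (f (Suc i))" by blast
  have le: "length y \<le> length x" if xy: "?step x y" for x y
  proof -
    obtain u v s t where "u \<in> lists (S - {e})" "v \<in> lists (S - {e})" "s \<in> S - {e}" "t \<in> S - {e}"
      "[s, t] \<noteq> N [s, t]" "x = u @ [s, t] @ v" "y = u @ erase e (N [s, t]) @ v"
      by (rule erased_step_cases[OF xy])
    moreover from this have "length (erase e (N [s, t])) \<le> 2"
      using length_filter_le[of "\<lambda>s. s \<noteq> e" "N [s, t]"] N_length[of "[s, t]"]
      by (simp add: erase_def)
    ultimately show ?thesis by simp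
  qed
  have norm_step: "rewrite_step S (norm_rules S N) x y" if xy: "?step x y" "length x \<le> length y" for x y
  proof -
    obtain u v s t where st: "u \<in> lists (S - {e})" "v \<in> lists (S - {e})" "s \<in> S - {e}" "t \<in> S - {e}"
      "[s, t] \<noteq> N [s, t]" 
      and eqs: "x = u @ [s, t] @ v" "y = u @ erase e (N [s, t]) @ v"
      by (rule erased_step_cases[OF xy(1)])
    have uv: "u \<in> lists S" "v \<in> lists S" "s \<in> S" "t \<in> S" using st(1-4) by auto
    have "length (N [s, t]) \<le> length (erase e (N [s, t]))"
      using xy(2) uv eqs N_length[of "[s, t]"] by simp
    then have "\<forall>a\<in>set (N [s, t]). a \<noteq> e"
      unfolding erase_def using length_filter_less[of e "N [s, t]" "\<lambda>s. s \<noteq> e"] by auto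
    then have "erase e (N [s, t]) = N [s, t]" unfolding erase_def by (rule filter_True)
    moreover have "([s, t], N [s, t]) \<in> norm_rules S N" using uv st(5) by (auto simp: norm_rules_def)
    ultimately show ?thesis unfolding eqs using rewrite_stepI[OF uv(1,2)] by metis
  qed
  \<comment> \<open>From an index of minimal length on, the length is constant.\<close>
  obtain k where k: "\<And>i. length (f k) \<le> length (f i)"
    using ex_has_least_nat[of "\<lambda>_. True" _ "\<lambda>i. length (f i)"] by blast
  have "length (f (k + i)) \<le> length (f k)" for i
    by (induction i) (auto intro: le_trans[OF le[OF f]])
  then have "rewrite_step S (norm_rules S N) (f (k + i)) (f (k + Suc i))" for i
    using f[of "k + i"] k[of "k + Suc i"] by (intro norm_step) (auto intro: le_trans)
  then show False
    using norm_rules_terminating unfolding terminating_def by (auto dest: spec[of _ "\<lambda>i. f (k + i)"])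
qed

context
  fixes e :: 'a
  assumes neutral: "neutral_element S N e"
begin

text \<open>Normalising the factor \<open>e # v\<close> first moves \<open>e\<close> to the right
  end, where neutrality splits it off.\<close>

lemma N_neutral_insert:
  assumes "u \<in> lists S" "v \<in> lists S"
  shows "N (u @ e # v) = N (u @ v) @ [e]"
proof -
  have e: "e \<in> S" "\<And>w. w \<in> lists S \<Longrightarrow> N (w @ [e]) = N w @ [e]" "\<And>w. w \<in> lists S \<Longrightarrow> N (e # w) = N w @ [e]"
    using neutral unfolding neutral_element_def by auto
  have "N (u @ e # v) = N (u @ N (e # v))" using N_inner[of u "[]" "e # v"] assms e by simp
  also have "\<dots> = N ((u @ N v) @ [e])" using assms e by simp
  also have "\<dots> = N (u @ N v) @ [e]" using assms e N_lists by (intro e) simp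
  also have "\<dots> = N (u @ v) @ [e]" using N_inner[of u "[]" v] assms by simp
  finally show ?thesis .
qed

text \<open>A letter \<open>e\<close> in \<open>w\<close> only adds a final \<open>e\<close> to the
  normal form, and the outer erasure removes it. Any other letter joins the left context, hence the
  induction over arbitrary \<open>u\<close>.\<close>

lemma erase_N_erase:
  "u \<in> lists S \<Longrightarrow> w \<in> lists S \<Longrightarrow> v \<in> lists S \<Longrightarrow>
    erase e (N (u @ erase e w @ v)) = erase e (N (u @ w @ v))"
proof (induction w arbitrary: u)
  case (Cons a w)
  show ?case
  proof (cases "a = e")
    case True
    then have "erase e (N (u @ (a # w) @ v)) = erase e (N (u @ w @ v))"
      using N_neutral_insert[of u "w @ v"] Cons.prems by (simp add: erase_def)
    then show ?thesis using Cons True by (simp add: erase_def)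
  next
    case False
    then show ?thesis using Cons.IH[of "u @ [a]"] Cons.prems by (simp add: erase_def)
  qed
qed (simp add: erase_def)

lemma erased_rules_convergent: "convergent_rewriting (S - {e}) (norm_rules_erased S N e)"
proof (rule convergent_by_invariant[where f = "\<lambda>w. erase e (N w)"])
  fix x y
  assume step: "rewrite_step (S - {e}) (norm_rules_erased S N e) x y"
  obtain u v s t where "u \<in> lists (S - {e})" "v \<in> lists (S - {e})" "s \<in> S - {e}" "t \<in> S - {e}"
    "[s, t] \<noteq> N [s, t]"
    and xy: "x = u @ [s, t] @ v" "y = u @ erase e (N [s, t]) @ v"
    by (rule erased_step_cases[OF step])
  then have *: "u \<in> lists S" "v \<in> lists S" "[s, t] \<in> lists S" by auto
  \<comment> \<open>Once the erased letters are restored, \<open>y\<close> differs from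
    \<open>x\<close> only by \<open>N\<close> applied to a factor.\<close>
  then have "erase e (N y) = erase e (N (u @ N [s, t] @ v))"
    unfolding xy by (intro erase_N_erase N_lists)
  also have "\<dots> = erase e (N x)" unfolding xy using N_inner * by simp
  finally show "erase e (N x) = erase e (N y)" ..
next
  fix x
  assume x: "x \<in> lists (S - {e})" "\<nexists>y. rewrite_step (S - {e}) (norm_rules_erased S N e) x y"
  have "N x = x"
  proof (rule N_fixes_if_factors_fixed)
    fix u s t v
    assume eq: "x = u @ [s, t] @ v"
    show "N [s, t] = [s, t]"
    proof (rule ccontr)
      assume "N [s, t] \<noteq> [s, t]"
      then have "([s, t], erase e (N [s, t])) \<in> norm_rules_erased S N e"
        using x(1) eq by (auto simp: norm_rules_erased_def)
      then have "rewrite_step (S - {e}) (norm_rules_erased S N e) x (u @ erase e (N [s, t]) @ v)"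
        unfolding eq by (intro rewrite_stepI) (use x(1) eq in auto)
      then show False using x(2) by blast
    qed
  qed (use x in auto)
  moreover have "erase e x = x" using x(1) by (auto simp: erase_def filter_id_conv)
  ultimately show "erase e (N x) = x" by simp
qed (rule erased_rules_rewriting_system erased_rules_terminating)+

end

end

theorem proposition5p1p1:
  fixes S :: "'a set" and N :: "'a list \<Rightarrow> 'a list"
  assumes "quadratic_normalisation S N"
    and "class_3_3 S N"
  shows "convergent_rewriting S (norm_rules S N) \<and>
    (\<forall>e. neutral_element S N e \<longrightarrow>
       convergent_rewriting (S - {e}) (norm_rules_erased S N e)) \<and>
    (\<forall>(p::nat) (l::nat) (ws :: nat \<Rightarrow> 'a list).
       ws 0 \<in> lists S \<and> length (ws 0) = p \<and>
       (\<forall>i<l. rewrite_step S (norm_rules S N) (ws i) (ws (Suc i)))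
       \<longrightarrow> l \<le> p * (p - 1) div 2)"
proof -
  interpret quadratic_3_3 S N using assms by unfold_locales
  show ?thesis
    using norm_rules_convergent erased_rules_convergent norm_rewriting_length by blast
qed

end
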